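(* Consider a network contribution game on a finite simple undirected graph $G=(V,E)$ with budgets $B_v\ge 0$ ($v\in V$) in which every reward function $f_e$ ($e\in E$) belongs to the class $\mathcal{C}_0$. Then a pairwise equilibrium exists and can be computed efficiently (in polynomial time).
   Context: Network contribution game: a finite simple undirected graph $G=(V,E)$; every node $v\in V$ is a player with budget $B_v\ge 0$. Let $E_v$ be the set of edges incident to $v$. A strategy of $v$ is a function $s_v:E_v\to\mathbb{R}_{\ge 0}$ with $\sum_{e\in E_v}s_v(e)\le B_v$; a state $s=(s_v)_{v\in V}$ consists of one strategy per player. Each edge $e=(u,v)$ has a reward function $f_e:\mathbb{R}_{\ge 0}^2\to\mathbb{R}_{\ge 0}$ that is nondecreasing in each argument, symmetric, continuous and differentiable. The utility of $v$ is $w_v(s)=\sum_{e=(v,u)\in E_v}f_e(s_v(e),s_u(e))$. A state $s$ is a (pure) Nash equilibrium if $w_v(s)\ge w_v(s_v',s_{-v})$ for every player $v$ and every strategy $s_v'$. An improving bilateral deviation in $s$ is a pair of strategies $(s_u',s_v')$ of two players $u\neq v$ with $w_u(s_u',s_v',s_{-u,v})>w_u(s)$ and $w_v(s_u',s_v',s_{-u,v})>w_v(s)$. A pairwise equilibrium is a Nash equilibrium that admits no improving bilateral deviation. A function $f$ is coordinate-convex if $\partial^2 f/\partial x_i^2\ge 0$ for each of its arguments $x_i$. The class $\mathcal{C}$ consists of all symmetric nondecreasing coordinate-convex functions $f:\mathbb{R}_{\ge0}\times\mathbb{R}_{\ge0}\to\mathbb{R}_{\ge0}$, and $\mathcal{C}_0$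 is the subclass of those $f\in\mathcal{C}$ with $f(x,0)=0$ for all $x\ge 0$. *)

theory Defs
  imports "HOL-Analysis.Analysis" "HOL-Computational_Algebra.Polynomial"
begin

section \<open>Reward functions\<close>

text \<open>A function on the closed quadrant of nonnegative pairs is a curried function whose
  values outside the quadrant play no role. Derivatives at boundary points are taken within
  the domain, i.e. they are one-sided.\<close>

definition nonneg_fun :: "(real \<Rightarrow> real \<Rightarrow> real) \<Rightarrow> bool" where
  "nonneg_fun f \<longleftrightarrow> (\<forall>x\<ge>0. \<forall>y\<ge>0. f x y \<ge> 0)"

definition nondecreasing :: "(real \<Rightarrow> real \<Rightarrow> real) \<Rightarrow> bool" where
  "nondecreasing f \<longleftrightarrow>
     (\<forall>y\<ge>0. mono_on {0..} (\<lambda>x. f x y)) \<and> (\<forall>x\<ge>0. mono_on {0..} (\<lambda>y. f x y))"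

definition symmetric_fun :: "(real \<Rightarrow> real \<Rightarrow> real) \<Rightarrow> bool" where
  "symmetric_fun f \<longleftrightarrow> (\<forall>x\<ge>0. \<forall>y\<ge>0. f x y = f y x)"

definition reward_function :: "(real \<Rightarrow> real \<Rightarrow> real) \<Rightarrow> bool" where
  "reward_function f \<longleftrightarrow> nonneg_fun f \<and> nondecreasing f \<and> symmetric_fun f \<and>
     continuous_on ({0..} \<times> {0..}) (\<lambda>(x, y). f x y) \<and>
     (\<lambda>(x, y). f x y) differentiable_on ({0..} \<times> {0..})"

definition second_derivative_nonneg :: "(real \<Rightarrow> real) \<Rightarrow> bool" where
  "second_derivative_nonneg g \<longleftrightarrow> (\<exists>g' g''. \<forall>x\<ge>0.
     (g has_real_derivative g' x) (at x within {0..}) \<and>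
     (g' has_real_derivative g'' x) (at x within {0..}) \<and> g'' x \<ge> 0)"

definition coordinate_convex :: "(real \<Rightarrow> real \<Rightarrow> real) \<Rightarrow> bool" where
  "coordinate_convex f \<longleftrightarrow>
     (\<forall>y\<ge>0. second_derivative_nonneg (\<lambda>x. f x y)) \<and>
     (\<forall>x\<ge>0. second_derivative_nonneg (\<lambda>y. f x y))"

definition class_C :: "(real \<Rightarrow> real \<Rightarrow> real) set" where
  "class_C = {f. nonneg_fun f \<and> symmetric_fun f \<and> nondecreasing f \<and> coordinate_convex f}"

definition class_C0 :: "(real \<Rightarrow> real \<Rightarrow> real) set" where
  "class_C0 = {f \<in> class_C. \<forall>x\<ge>0. f x 0 = 0}"


section \<open>Network contribution games\<close>

record 'v game =
  verts :: "'v set"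
  edges :: "'v set set"
  budget :: "'v \<Rightarrow> real"
  reward :: "'v set \<Rightarrow> real \<Rightarrow> real \<Rightarrow> real"

definition network_contribution_game :: "'v game \<Rightarrow> bool" where
  "network_contribution_game G \<longleftrightarrow>
     finite (verts G) \<and> (\<forall>e\<in>edges G. e \<subseteq> verts G \<and> card e = 2) \<and>
     (\<forall>v\<in>verts G. budget G v \<ge> 0) \<and> (\<forall>e\<in>edges G. reward_function (reward G e))"

definition incident :: "'v game \<Rightarrow> 'v \<Rightarrow> 'v set set" where
  "incident G v = {e \<in> edges G. v \<in> e}"

text \<open>Strategies are total functions on edges; only their values on the incident edges are
  constrained, and only these enter the utilities.\<close>

definition strategies :: "'v game \<Rightarrow> 'v \<Rightarrow> ('v set \<Rightarrow> real) set" where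
  "strategies G v = {\<sigma> \<in> incident G v \<rightarrow> {0..}. (\<Sum>e\<in>incident G v. \<sigma> e) \<le> budget G v}"

definition game_state :: "'v game \<Rightarrow> ('v \<Rightarrow> 'v set \<Rightarrow> real) \<Rightarrow> bool" where
  "game_state G s \<longleftrightarrow> (\<forall>v\<in>verts G. s v \<in> strategies G v)"

definition utility :: "'v game \<Rightarrow> 'v \<Rightarrow> ('v \<Rightarrow> 'v set \<Rightarrow> real) \<Rightarrow> real" where
  "utility G v s = (\<Sum>u | {v, u} \<in> edges G. reward G {v, u} (s v {v, u}) (s u {v, u}))"

definition nash_equilibrium :: "'v game \<Rightarrow> ('v \<Rightarrow> 'v set \<Rightarrow> real) \<Rightarrow> bool" where
  "nash_equilibrium G s \<longleftrightarrow> game_state G s \<and>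
     (\<forall>v\<in>verts G. \<forall>\<sigma>\<in>strategies G v. utility G v s \<ge> utility G v (s(v := \<sigma>)))"

definition improving_bilateral_deviation ::
  "'v game \<Rightarrow> ('v \<Rightarrow> 'v set \<Rightarrow> real) \<Rightarrow> 'v \<Rightarrow> 'v \<Rightarrow> ('v set \<Rightarrow> real) \<Rightarrow> ('v set \<Rightarrow> real) \<Rightarrow> bool" where
  "improving_bilateral_deviation G s u v \<sigma> \<tau> \<longleftrightarrow>
     u \<in> verts G \<and> v \<in> verts G \<and> u \<noteq> v \<and> \<sigma> \<in> strategies G u \<and> \<tau> \<in> strategies G v \<and>
     utility G u (s(u := \<sigma>, v := \<tau>)) > utility G u s \<and>
     utility G v (s(u := \<sigma>, v := \<tau>)) > utility G v s"

definition pairwise_equilibrium :: "'v game \<Rightarrow> ('v \<Rightarrow> 'v set \<Rightarrow> real) \<Rightarrow> bool" where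
  "pairwise_equilibrium G s \<longleftrightarrow> nash_equilibrium G s \<and>
     \<not> (\<exists>u v \<sigma> \<tau>. improving_bilateral_deviation G s u v \<sigma> \<tau>)"


section \<open>Computation on a real random access machine with a reward oracle\<close>

text \<open>Programs are finite pieces of syntax over named, unbounded arrays of naturals and of
  reals; a scalar variable is the cell of an array at index 0. Reals support exact
  arithmetic and comparison at unit cost, and the reward functions, being arbitrary real
  functions, are accessible only through an evaluation oracle: \<open>Query i x y\<close> evaluates the
  reward function of the edge with number \<open>i\<close>. There is no conversion from reals to naturals
  (no rounding), constants are rational, and naturals have no multiplication, so that their
  bit length grows at most linearly with the number of steps.\<close>

datatype nexp =
    NConst nat
  | NCell string nexp
  | NAdd nexp nexp
  | NSub nexp nexp

datatype rexp =
    RConst rat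
  | RCell string nexp
  | RAdd rexp rexp
  | RSub rexp rexp
  | RMul rexp rexp
  | RDiv rexp rexp
  | Query nexp rexp rexp

datatype bexp =
    NLess nexp nexp
  | RLess rexp rexp
  | BNot bexp
  | BAnd bexp bexp

datatype com =
    Skip
  | NAssign string nexp nexp \<comment> \<open>array, index, new value\<close>
  | RAssign string nexp rexp
  | Seq com com
  | Cond bexp com com
  | While bexp com

record memory =
  ncell :: "string \<Rightarrow> nat \<Rightarrow> nat"
  rcell :: "string \<Rightarrow> nat \<Rightarrow> real"

type_synonym oracle_fun = "nat \<Rightarrow> real \<Rightarrow> real \<Rightarrow> real"

primrec nval :: "nexp \<Rightarrow> memory \<Rightarrow> nat" where
  "nval (NConst k) M = k"
| "nval (NCell a i) M = ncell M a (nval i M)"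
| "nval (NAdd i j) M = nval i M + nval j M"
| "nval (NSub i j) M = nval i M - nval j M"

primrec rval :: "oracle_fun \<Rightarrow> rexp \<Rightarrow> memory \<Rightarrow> real" where
  "rval q (RConst c) M = of_rat c"
| "rval q (RCell a i) M = rcell M a (nval i M)"
| "rval q (RAdd x y) M = rval q x M + rval q y M"
| "rval q (RSub x y) M = rval q x M - rval q y M"
| "rval q (RMul x y) M = rval q x M * rval q y M"
| "rval q (RDiv x y) M = rval q x M / rval q y M"
| "rval q (Query i x y) M = q (nval i M) (rval q x M) (rval q y M)"

primrec bval :: "oracle_fun \<Rightarrow> bexp \<Rightarrow> memory \<Rightarrow> bool" where
  "bval q (NLess i j) M \<longleftrightarrow> nval i M < nval j M"
| "bval q (RLess x y) M \<longleftrightarrow> rval q x M < rval q y M"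
| "bval q (BNot b) M \<longleftrightarrow> \<not> bval q b M"
| "bval q (BAnd b b') M \<longleftrightarrow> bval q b M \<and> bval q b' M"

definition nset :: "string \<Rightarrow> nat \<Rightarrow> nat \<Rightarrow> memory \<Rightarrow> memory" where
  "nset a i k M = M\<lparr>ncell := (ncell M)(a := (ncell M a)(i := k))\<rparr>"

definition rset :: "string \<Rightarrow> nat \<Rightarrow> real \<Rightarrow> memory \<Rightarrow> memory" where
  "rset a i x M = M\<lparr>rcell := (rcell M)(a := (rcell M a)(i := x))\<rparr>"

text \<open>\<open>exec q c M t M'\<close>: with oracle \<open>q\<close>, the program \<open>c\<close> started in memory \<open>M\<close> halts in
  memory \<open>M'\<close> after \<open>t\<close> steps. An assignment or a test counts as one step: the expressions
  in it belong to the fixed program, so evaluating them takes a constant number of machine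
  operations and oracle calls.\<close>

inductive exec :: "oracle_fun \<Rightarrow> com \<Rightarrow> memory \<Rightarrow> nat \<Rightarrow> memory \<Rightarrow> bool" for q where
  Skip: "exec q Skip M 1 M"
| NAssign: "exec q (NAssign a i e) M 1 (nset a (nval i M) (nval e M) M)"
| RAssign: "exec q (RAssign a i e) M 1 (rset a (nval i M) (rval q e M) M)"
| Seq: "exec q c1 M1 t1 M2 \<Longrightarrow> exec q c2 M2 t2 M3 \<Longrightarrow> exec q (Seq c1 c2) M1 (t1 + t2) M3"
| CondTrue: "bval q b M \<Longrightarrow> exec q c1 M t M' \<Longrightarrow> exec q (Cond b c1 c2) M (1 + t) M'"
| CondFalse: "\<not> bval q b M \<Longrightarrow> exec q c2 M t M' \<Longrightarrow> exec q (Cond b c1 c2) M (1 + t) M'"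
| WhileFalse: "\<not> bval q b M \<Longrightarrow> exec q (While b c) M 1 M"
| WhileTrue: "bval q b M1 \<Longrightarrow> exec q c M1 t1 M2 \<Longrightarrow> exec q (While b c) M2 t2 M3 \<Longrightarrow>
    exec q (While b c) M1 (1 + t1 + t2) M3"

inductive_cases exec_SkipE: "exec q Skip M t M'"
  and exec_NAssignE: "exec q (NAssign a i e) M t M'"
  and exec_RAssignE: "exec q (RAssign a i e) M t M'"
  and exec_SeqE: "exec q (Seq c1 c2) M t M'"
  and exec_CondE: "exec q (Cond b c1 c2) M t M'"
  and exec_WhileE: "exec q (While b c) M t M'"

lemma exec_deterministic:
  "exec q c M t M' \<Longrightarrow> exec q c M u M'' \<Longrightarrow> t = u \<and> M' = M''"
proof (induction arbitrary: u M'' rule: exec.induct)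
  case (Skip M)
  then show ?case by (rule exec_SkipE) simp
next
  case (NAssign a i e M)
  then show ?case by (rule exec_NAssignE) simp
next
  case (RAssign a i e M)
  then show ?case by (rule exec_RAssignE) simp
next
  case (Seq c1 M1 t1 M2 c2 t2 M3)
  from Seq.prems show ?case by (rule exec_SeqE) (metis Seq.IH)
next
  case (CondTrue b M c1 t M' c2)
  from CondTrue.prems show ?case by (rule exec_CondE) (use CondTrue.hyps(1) in \<open>auto dest: CondTrue.IH\<close>)
next
  case (CondFalse b M c2 t M' c1)
  from CondFalse.prems show ?case by (rule exec_CondE) (use CondFalse.hyps(1) in \<open>auto dest: CondFalse.IH\<close>)
next
  case (WhileFalse b M c)
  from WhileFalse.prems show ?case by (rule exec_WhileE) (use WhileFalse.hyps in simp_all)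
next
  case (WhileTrue b M1 c t1 M2 t2 M3)
  from WhileTrue.prems show ?case
    by (rule exec_WhileE) (use WhileTrue.hyps(1) in \<open>auto dest: WhileTrue.IH\<close>)
qed


section \<open>Games as inputs, states as outputs\<close>

text \<open>A game is presented by a list of its vertices and a list of its edges, an edge being
  given by the positions of its two endpoints (in either order) in the vertex list.\<close>

definition edge_at :: "'v list \<Rightarrow> nat \<times> nat \<Rightarrow> 'v set" where
  "edge_at vs p = {vs ! fst p, vs ! snd p}"

definition presents :: "'v list \<Rightarrow> (nat \<times> nat) list \<Rightarrow> 'v game \<Rightarrow> bool" where
  "presents vs es G \<longleftrightarrow> distinct vs \<and> set vs = verts G \<and>
     (\<forall>(i, j)\<in>set es. i < length vs \<and> j < length vs) \<and>
     distinct (map (edge_at vs) es) \<and> edge_at vs ` set es = edges G"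

definition input_memory :: "'v list \<Rightarrow> (nat \<times> nat) list \<Rightarrow> 'v game \<Rightarrow> memory" where
  "input_memory vs es G = \<lparr>
     ncell = (\<lambda>a i.
       if a = ''n'' \<and> i = 0 then length vs
       else if a = ''m'' \<and> i = 0 then length es
       else if a = ''fst'' \<and> i < length es then fst (es ! i)
       else if a = ''snd'' \<and> i < length es then snd (es ! i)
       else 0),
     rcell = (\<lambda>a i. if a = ''budget'' \<and> i < length vs then budget G (vs ! i) else 0)\<rparr>"

definition reward_oracle :: "'v list \<Rightarrow> (nat \<times> nat) list \<Rightarrow> 'v game \<Rightarrow> oracle_fun" where
  "reward_oracle vs es G = (\<lambda>i x y.
     if i < length es \<and> 0 \<le> x \<and> 0 \<le> y then reward G (edge_at vs (es ! i)) x y else 0)"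

text \<open>The output lists, for every edge, the contributions of its two endpoints. This
  determines all values of a state that matter.\<close>

definition output_state ::
  "'v list \<Rightarrow> (nat \<times> nat) list \<Rightarrow> memory \<Rightarrow> ('v \<Rightarrow> 'v set \<Rightarrow> real) \<Rightarrow> bool" where
  "output_state vs es M s \<longleftrightarrow> (\<forall>k<length es.
     s (vs ! fst (es ! k)) (edge_at vs (es ! k)) = rcell M ''out_fst'' k \<and>
     s (vs ! snd (es ! k)) (edge_at vs (es ! k)) = rcell M ''out_snd'' k)"

end

theory Submission imports Defs begin

text \<open>Call the value of an edge its reward when both endpoints invest their whole budgets in
  it. Greedily pick an edge of maximal value among those disjoint from the edges picked before,
  and let the endpoints of every picked edge invest everything in it. Since \<open>f x 0 = 0\<close>,
  the rewards that a deviating player can reach come from the edge to the partner and, in a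
  bilateral deviation, from the edge to the fellow deviator. By convexity each of them is at most
  the fraction of the budget invested there times the reward at full investment. Hence a
  player whose picked edge is at least as valuable as the edge to the fellow deviator cannot gain,
  and greediness provides such a player among any two adjacent deviators.\<close>

section \<open>Stable matchings and pairwise equilibria\<close>

text \<open>The mean slopes of \<open>g\<close> on \<open>[0, x]\<close> and \<open>[x, b]\<close>
  are values of \<open>g'\<close>, which is nondecreasing as \<open>g''\<close> is nonnegative; with
  \<open>g 0 = 0\<close> the first slope is \<open>g x / x\<close>. The bound is multiplied out so
  that zero arguments are covered.\<close>

lemma second_derivative_nonneg_imp_star_shaped:
  fixes g :: "real \<Rightarrow> real"
  assumes "second_derivative_nonneg g" "g 0 = 0" "0 \<le> x" "x \<le> b"
  shows "b * g x \<le> x * g b"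
proof -
  obtain g' g'' where d: "\<And>x. x \<ge> 0 \<Longrightarrow> (g has_real_derivative g' x) (at x within {0..})"
    and d': "\<And>x. x \<ge> 0 \<Longrightarrow> (g' has_real_derivative g'' x) (at x within {0..})"
    and nn: "\<And>x. x \<ge> 0 \<Longrightarrow> g'' x \<ge> 0"
    using assms(1) unfolding second_derivative_nonneg_def by blast
  \<comment> \<open>At positive points the one-sided derivative is two-sided, so the mean value
    theorem applies even on intervals that start at 0.\<close>
  have at: "at x within {0..} = at x" if "x > 0" for x :: real
    using that by (intro at_within_interior) simp
  have cont: "continuous_on {u..v} h"
    if "\<And>x. x \<ge> 0 \<Longrightarrow> (h has_real_derivative h' x) (at x within {0..})" "0 \<le> u"
    for h h' :: "real \<Rightarrow> real" and u v
    unfolding continuous_on_eq_continuous_within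
  proof
    fix x assume x: "x \<in> {u..v}"
    then have "(h has_real_derivative h' x) (at x within {u..v})"
      using that by (intro DERIV_subset[OF that(1)]) auto
    then show "continuous (at x within {u..v}) h" by (rule DERIV_continuous)
  qed
  \<comment> \<open>Stated for a general pair \<open>h\<close>, \<open>h'\<close> because it serves
    both \<open>g\<close> with \<open>g'\<close> and \<open>g'\<close> with
    \<open>g''\<close>.\<close>
  have mvt': "\<exists>z>u. z < v \<and> h v - h u = (v - u) * h' z"
    if h: "\<And>x. x \<ge> 0 \<Longrightarrow> (h has_real_derivative h' x) (at x within {0..})" and "0 \<le> u" "u < v"
    for h h' :: "real \<Rightarrow> real" and u v
  proof -
    have "\<exists>l z. u < z \<and> z < v \<and> DERIV h z :> l \<and> h v - h u = (v - u) * l"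
    proof (rule MVT[OF \<open>u < v\<close> cont[OF h \<open>0 \<le> u\<close>]])
      fix x assume "u < x" "x < v"
      then show "h differentiable (at x)"
        using h[of x] at[of x] \<open>0 \<le> u\<close> by (auto simp: real_differentiable_def)
    qed auto
    then obtain l z where z: "u < z" "z < v" "DERIV h z :> l" "h v - h u = (v - u) * l"
      by blast
    moreover have "l = h' z"
      using z h[of z] at[of z] \<open>0 \<le> u\<close> by (auto intro: DERIV_unique)
    ultimately show ?thesis by blast
  qed
  consider "x = 0" | "x = b" | "0 < x" "x < b"
    using assms by linarith
  then show ?thesis
  proof cases
    case 3
    obtain y where y: "0 < y" "y < x" "g x - g 0 = (x - 0) * g' y"
      using mvt'[OF d, of 0 x] 3 by auto
    obtain z where z: "x < z" "z < b" "g b - g x = (b - x) * g' z"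
      using mvt'[OF d, of x b] 3 by auto
    obtain w where w: "y < w" "w < z" "g' z - g' y = (z - y) * g'' w"
      using mvt'[OF d', of y z] y z by auto
    have "0 \<le> (z - y) * g'' w"
      using w(1,2) y(1) nn by (intro mult_nonneg_nonneg) auto
    then have "g' y \<le> g' z"
      unfolding w(3)[symmetric] by simp
    then have "(b - x) * (x * g' y) \<le> x * ((b - x) * g' z)"
      using 3 by (simp add: mult.left_commute mult_left_mono)
    moreover have "x * g' y = g x" "(b - x) * g' z = g b - g x"
      using y(3) z(3) assms(2) by simp_all
    ultimately have "(b - x) * g x \<le> x * (g b - g x)"
      by simp
    then show ?thesis
      by (simp add: algebra_simps)
  qed (use assms in auto)
qed

section \<open>Edge values, matchings and bounds on utilities\<close>

definition full_reward :: "'v game \<Rightarrow> 'v \<Rightarrow> 'v \<Rightarrow> real" where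
  "full_reward G u v = reward G {u, v} (budget G u) (budget G v)"

text \<open>The last clause is stability: no edge beats the matched edges of both its endpoints. An
  endpoint without a matched edge cannot serve as the witness; a matched edge is its own
  witness.\<close>

definition stable_matching :: "'v game \<Rightarrow> 'v set set \<Rightarrow> bool" where
  "stable_matching G X \<longleftrightarrow> X \<subseteq> edges G \<and>
     (\<forall>e\<in>X. \<forall>e'\<in>X. e \<inter> e' \<noteq> {} \<longrightarrow> e = e') \<and>
     (\<forall>u v. {u, v} \<in> edges G \<longrightarrow>
       (\<exists>w. {u, w} \<in> X \<and> full_reward G u v \<le> full_reward G u w) \<or>
       (\<exists>w. {v, w} \<in> X \<and> full_reward G v u \<le> full_reward G v w))"

text \<open>There is no test for \<open>v \<in> e\<close>, since strategies and utilities read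
  \<open>v\<close> only on its own edges.\<close>

definition matching_state :: "'v game \<Rightarrow> 'v set set \<Rightarrow> 'v \<Rightarrow> 'v set \<Rightarrow> real" where
  "matching_state G X = (\<lambda>v e. if e \<in> X then budget G v else 0)"

locale c0_game =
  fixes G :: "'v game"
  assumes game: "network_contribution_game G"
    and c0: "e \<in> edges G \<Longrightarrow> reward G e \<in> class_C0"
begin

lemma finite_verts: "finite (verts G)"
  and budget_nonneg: "v \<in> verts G \<Longrightarrow> 0 \<le> budget G v"
  using game by (auto simp: network_contribution_game_def)

lemma edge_verts: "{u, v} \<in> edges G \<Longrightarrow> u \<in> verts G \<and> v \<in> verts G"
  and edge_neq: "{u, v} \<in> edges G \<Longrightarrow> u \<noteq> v"
  using game by (auto simp: network_contribution_game_def)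

lemma finite_edges: "finite (edges G)"
  by (rule finite_subset[of _ "Pow (verts G)"])
    (use game finite_verts in \<open>auto simp: network_contribution_game_def\<close>)

lemma finite_incident: "finite (incident G v)"
  using finite_edges by (simp add: incident_def)

lemma finite_neighbours: "finite {u. {v, u} \<in> edges G}"
  by (rule finite_subset[OF _ finite_verts]) (auto dest: edge_verts)

lemma reward_nonneg: "e \<in> edges G \<Longrightarrow> 0 \<le> x \<Longrightarrow> 0 \<le> y \<Longrightarrow> 0 \<le> reward G e x y"
  and reward_commute: "e \<in> edges G \<Longrightarrow> 0 \<le> x \<Longrightarrow> 0 \<le> y \<Longrightarrow> reward G e x y = reward G e y x"
  and reward_zero: "e \<in> edges G \<Longrightarrow> 0 \<le> x \<Longrightarrow> reward G e x 0 = 0"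
  using c0[of e] by (auto simp: class_C0_def class_C_def nonneg_fun_def symmetric_fun_def)

lemma reward_zero_left: "e \<in> edges G \<Longrightarrow> 0 \<le> y \<Longrightarrow> reward G e 0 y = 0"
  using reward_commute[of e 0 y] reward_zero by simp

lemma reward_mono_right:
  "e \<in> edges G \<Longrightarrow> 0 \<le> x \<Longrightarrow> 0 \<le> y \<Longrightarrow> y \<le> z \<Longrightarrow> reward G e x y \<le> reward G e x z"
  using c0[of e]
  by (auto simp: class_C0_def class_C_def nondecreasing_def intro: mono_onD)

text \<open>The convexity bound for a player's own contribution, with the partner's contribution
  held fixed; the value 0 at the origin comes from \<open>f x 0 = 0\<close> by symmetry.\<close>

lemma reward_star_shaped:
  assumes "e \<in> edges G" "0 \<le> x" "x \<le> b" "0 \<le> y"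
  shows "b * reward G e x y \<le> x * reward G e b y"
  using assms c0[of e]
  by (intro second_derivative_nonneg_imp_star_shaped[of "\<lambda>x. reward G e x y"] reward_zero_left)
    (auto simp: class_C0_def class_C_def coordinate_convex_def)

lemma full_reward_commute: "{u, v} \<in> edges G \<Longrightarrow> full_reward G u v = full_reward G v u"
  using edge_verts[of u v] reward_commute[of "{u, v}"] budget_nonneg
  by (auto simp: full_reward_def insert_commute)

lemma strategy_nonneg: "\<sigma> \<in> strategies G v \<Longrightarrow> {v, u} \<in> edges G \<Longrightarrow> 0 \<le> \<sigma> {v, u}"
  by (auto simp: strategies_def incident_def)

text \<open>Budgets bound sums over incident edges, utilities are sums over neighbours; the map from
  neighbours to edges is injective.\<close>

lemma strategy_sum:
  assumes "\<sigma> \<in> strategies G v"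
  shows "(\<Sum>u | {v, u} \<in> edges G. \<sigma> {v, u}) \<le> budget G v"
proof -
  have "inj_on (\<lambda>u. {v, u}) {u. {v, u} \<in> edges G}"
    by (auto simp: inj_on_def doubleton_eq_iff)
  then have "(\<Sum>u | {v, u} \<in> edges G. \<sigma> {v, u}) = sum \<sigma> ((\<lambda>u. {v, u}) ` {u. {v, u} \<in> edges G})"
    by (simp add: sum.reindex o_def)
  also have "\<dots> \<le> sum \<sigma> (incident G v)"
    using assms by (intro sum_mono2 finite_incident) (auto simp: incident_def strategies_def)
  finally show ?thesis
    using assms by (simp add: strategies_def)
qed

lemma strategy_le_budget:
  assumes "\<sigma> \<in> strategies G v" "{v, u} \<in> edges G"
  shows "\<sigma> {v, u} \<le> budget G v"
proof -
  have "\<sigma> {v, u} \<le> (\<Sum>u | {v, u} \<in> edges G. \<sigma> {v, u})"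
    using assms strategy_nonneg
    by (intro member_le_sum[of u _ "\<lambda>u. \<sigma> {v, u}"]) (auto simp: finite_neighbours)
  then show ?thesis
    using strategy_sum[OF assms(1)] by simp
qed

text \<open>By convexity, splitting the budget of \<open>v\<close> is never better than spending it all on the
  best edge.\<close>

lemma utility_le:
  assumes strat: "s v \<in> strategies G v" and v: "v \<in> verts G" and K: "0 \<le> K"
    and nonneg: "\<And>u. {v, u} \<in> edges G \<Longrightarrow> 0 \<le> s u {v, u}"
    and le: "\<And>u. {v, u} \<in> edges G \<Longrightarrow> reward G {v, u} (budget G v) (s u {v, u}) \<le> K"
  shows "utility G v s \<le> K"
\<comment> \<open>The convexity bound carries the budget as a factor and says nothing when it is 0;
  then all contributions of \<open>v\<close> vanish, and so do the rewards.\<close>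
proof (cases "budget G v = 0")
  case True
  have "reward G {v, u} (s v {v, u}) (s u {v, u}) = 0" if "{v, u} \<in> edges G" for u
  proof -
    have "s v {v, u} = 0"
      using strategy_nonneg[OF strat that] strategy_le_budget[OF strat that] True by simp
    then show ?thesis using reward_zero_left[OF that nonneg[OF that]] by simp
  qed
  then show ?thesis using K by (simp add: utility_def)
next
  case False
  then have pos: "0 < budget G v" using budget_nonneg[OF v] by simp
  have "budget G v * utility G v s
      = (\<Sum>u | {v, u} \<in> edges G. budget G v * reward G {v, u} (s v {v, u}) (s u {v, u}))"
    by (simp add: utility_def sum_distrib_left)
  also have "\<dots> \<le> (\<Sum>u | {v, u} \<in> edges G. s v {v, u} * K)"
  proof (rule sum_mono, clarify)
    fix u assume e: "{v, u} \<in> edges G"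
    have "budget G v * reward G {v, u} (s v {v, u}) (s u {v, u})
        \<le> s v {v, u} * reward G {v, u} (budget G v) (s u {v, u})"
      using e strat by (intro reward_star_shaped strategy_nonneg strategy_le_budget nonneg)
    also have "\<dots> \<le> s v {v, u} * K"
      using e strat by (intro mult_left_mono le strategy_nonneg)
    finally show "budget G v * reward G {v, u} (s v {v, u}) (s u {v, u}) \<le> s v {v, u} * K" .
  qed
  also have "\<dots> \<le> budget G v * K"
    using strategy_sum[OF strat] K by (simp flip: sum_distrib_right add: mult_right_mono)
  finally show ?thesis using pos by simp
qed

section \<open>Stable matchings yield pairwise equilibria\<close>

context
  fixes X :: "'v set set"
  assumes stable: "stable_matching G X"
begin

lemma matching_edges: "e \<in> X \<Longrightarrow> e \<in> edges G"
  and matching_disjoint: "e \<in> X \<Longrightarrow> e' \<in> X \<Longrightarrow> x \<in> e \<Longrightarrow> x \<in> e' \<Longrightarrow> e = e'"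
  using stable unfolding stable_matching_def by blast+

text \<open>By disjointness at most one edge of \<open>X\<close> is incident to \<open>v\<close>, so
  the budget is spent at most once.\<close>

lemma matching_state_strategy:
  assumes v: "v \<in> verts G"
  shows "matching_state G X v \<in> strategies G v"
proof -
  have "(\<Sum>e\<in>incident G v. matching_state G X v e)
      = (\<Sum>e | e \<in> incident G v \<and> e \<in> X. budget G v)"
    by (simp add: matching_state_def sum.inter_filter[symmetric] finite_incident)
  also have "\<dots> \<le> budget G v"
  proof -
    have "card {e. e \<in> incident G v \<and> e \<in> X} \<le> 1"
      unfolding One_nat_def
      by (subst card_le_Suc0_iff_eq)
        (use matching_disjoint in \<open>auto simp: finite_edges incident_def\<close>)
    then show ?thesis
      using mult_right_mono[of "real (card {e. e \<in> incident G v \<and> e \<in> X})" 1 "budget G v"]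
        budget_nonneg[OF v] by simp
  qed
  finally show ?thesis
    using budget_nonneg[OF v] by (auto simp: strategies_def matching_state_def)
qed

lemma matching_state_nonneg: "v \<in> verts G \<Longrightarrow> 0 \<le> matching_state G X v e"
  using budget_nonneg by (simp add: matching_state_def)

lemma reward_matching_state_nonneg:
  "{v, u} \<in> edges G \<Longrightarrow>
    0 \<le> reward G {v, u} (matching_state G X v {v, u}) (matching_state G X u {v, u})"
  using edge_verts[of v u] by (intro reward_nonneg matching_state_nonneg) auto

lemma utility_matching_state_nonneg: "0 \<le> utility G v (matching_state G X)"
  unfolding utility_def by (intro sum_nonneg) (simp add: reward_matching_state_nonneg)

lemma full_reward_le_utility:
  assumes "{v, w} \<in> X"
  shows "full_reward G v w \<le> utility G v (matching_state G X)"
proof -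
  let ?r = "\<lambda>u. reward G {v, u} (matching_state G X v {v, u}) (matching_state G X u {v, u})"
  have "?r w \<le> (\<Sum>u | {v, u} \<in> edges G. ?r u)"
    using assms matching_edges reward_matching_state_nonneg
    by (intro member_le_sum[of w _ ?r]) (auto simp: finite_neighbours)
  then show ?thesis
    using assms by (simp add: utility_def full_reward_def matching_state_def)
qed

text \<open>On an unmatched edge \<open>u\<close> contributes nothing and the reward is 0; on a
  matched edge \<open>v\<close> already collects the full reward.\<close>

lemma reward_to_matching_state_le:
  assumes "{v, u} \<in> edges G"
  shows "reward G {v, u} (budget G v) (matching_state G X u {v, u})
    \<le> utility G v (matching_state G X)"
proof (cases "{v, u} \<in> X")
  case True
  then show ?thesis
    using full_reward_le_utility[OF True] by (simp add: matching_state_def full_reward_def)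
next
  case False
  then show ?thesis
    using assms edge_verts[of v u] utility_matching_state_nonneg
    by (simp add: matching_state_def reward_zero budget_nonneg)
qed

text \<open>Treats unilateral and bilateral deviations together: besides \<open>v\<close> only
  \<open>u\<close> may deviate. By \<open>utility_le\<close> it suffices to bound the reward of full
  investment in a single edge. If \<open>u\<close> deviates, monotonicity and the budget of
  \<open>u\<close> bound it by \<open>full_reward G v u\<close>, which the matched edge of
  \<open>v\<close> attains.\<close>

lemma no_gain:
  assumes v: "v \<in> verts G" and strat: "s v \<in> strategies G v"
    and others: "\<And>w. w \<noteq> u \<Longrightarrow> w \<noteq> v \<Longrightarrow> s w = matching_state G X w"
    and fellow: "{v, u} \<in> edges G \<Longrightarrow> s u = matching_state G X u \<or>
      s u \<in> strategies G u \<and> (\<exists>w. {v, w} \<in> X \<and> full_reward G v u \<le> full_reward G v w)"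
  shows "utility G v s \<le> utility G v (matching_state G X)"
proof -
  have "0 \<le> s w {v, w} \<and>
      reward G {v, w} (budget G v) (s w {v, w}) \<le> utility G v (matching_state G X)"
    if e: "{v, w} \<in> edges G" for w
  proof (cases "s w = matching_state G X w")
    case True
    then show ?thesis
      using edge_verts[OF e] matching_state_nonneg reward_to_matching_state_le[OF e] by simp
  next
    case False
    then have "w = u" using others edge_neq[OF e] by blast
    with False e fellow obtain x where su: "s u \<in> strategies G u"
      and x: "{v, x} \<in> X" "full_reward G v u \<le> full_reward G v x" by blast
    have e': "{u, v} \<in> edges G" using e \<open>w = u\<close> by (simp add: insert_commute)
    have bounds: "0 \<le> s u {v, u}" "s u {v, u} \<le> budget G u"
      using strategy_nonneg[OF su e'] strategy_le_budget[OF su e'] by (simp_all add: insert_commute)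
    have "reward G {v, u} (budget G v) (s u {v, u}) \<le> full_reward G v u"
      unfolding full_reward_def
      using e \<open>w = u\<close> bounds budget_nonneg[OF v] by (intro reward_mono_right) auto
    also have "\<dots> \<le> utility G v (matching_state G X)"
      using x full_reward_le_utility[of v x] by simp
    finally show ?thesis using bounds \<open>w = u\<close> by simp
  qed
  then show ?thesis
    by (intro utility_le strat v utility_matching_state_nonneg) auto
qed

theorem pairwise_equilibrium_matching_state: "pairwise_equilibrium G (matching_state G X)"
proof -
  let ?s = "matching_state G X"
  have "utility G v (?s(v := \<sigma>)) \<le> utility G v ?s"
    if "v \<in> verts G" "\<sigma> \<in> strategies G v" for v \<sigma>
    \<comment> \<open>With \<open>v\<close> as its own fellow deviator, the last premise is vacuous
      because there are no loops.\<close>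
    by (rule no_gain[of _ _ v]) (use that edge_neq[of v v] in auto)
  then have "nash_equilibrium G ?s"
    by (auto simp: nash_equilibrium_def game_state_def matching_state_strategy)
  moreover have False if "improving_bilateral_deviation G ?s u v \<sigma> \<tau>" for u v \<sigma> \<tau>
  proof -
    let ?t = "?s(u := \<sigma>, v := \<tau>)"
    have d: "u \<in> verts G" "v \<in> verts G" "u \<noteq> v" "\<sigma> \<in> strategies G u" "\<tau> \<in> strategies G v"
      "utility G u ?s < utility G u ?t" "utility G v ?s < utility G v ?t"
      using that by (auto simp: improving_bilateral_deviation_def)
    have "{u, v} \<in> edges G \<Longrightarrow>
      (\<exists>w. {u, w} \<in> X \<and> full_reward G u v \<le> full_reward G u w) \<or>
      (\<exists>w. {v, w} \<in> X \<and> full_reward G v u \<le> full_reward G v w)"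
      using stable by (auto simp: stable_matching_def)
    \<comment> \<open>Stability tells which of two adjacent deviators cannot gain; for nonadjacent
      ones the premise on the fellow deviator is vacuous.\<close>
    then have "utility G u ?t \<le> utility G u ?s \<or> utility G v ?t \<le> utility G v ?s"
      using no_gain[of u ?t v] no_gain[of v ?t u] d by (auto simp: insert_commute)
    then show False using d by linarith
  qed
  ultimately show ?thesis by (auto simp: pairwise_equilibrium_def)
qed

end

end


section \<open>Time-bounded total correctness\<close>

text \<open>\<open>T\<close> is only an upper bound, so branches of different length share one
  bound. Since \<open>Q\<close> is any predicate on memories, the claim about a second command can
  be the postcondition of the first.\<close>

definition halts_within ::
  "oracle_fun \<Rightarrow> com \<Rightarrow> memory \<Rightarrow> nat \<Rightarrow> (memory \<Rightarrow> bool) \<Rightarrow> bool" where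
  "halts_within q c M T Q \<longleftrightarrow> (\<exists>t M'. exec q c M t M' \<and> t \<le> T \<and> Q M')"

lemma halts_within_Skip: "Q M \<Longrightarrow> halts_within q Skip M 1 Q"
  unfolding halts_within_def by (blast intro: exec.Skip)

lemma halts_within_NAssign:
  "Q (nset a (nval i M) (nval e M) M) \<Longrightarrow> halts_within q (NAssign a i e) M 1 Q"
  unfolding halts_within_def by (blast intro: exec.NAssign)

lemma halts_within_RAssign:
  "Q (rset a (nval i M) (rval q e M) M) \<Longrightarrow> halts_within q (RAssign a i e) M 1 Q"
  unfolding halts_within_def by (blast intro: exec.RAssign)

lemma halts_within_Seq:
  assumes "halts_within q c1 M T1 (\<lambda>M'. halts_within q c2 M' T2 Q)"
  shows "halts_within q (Seq c1 c2) M (T1 + T2) Q"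
  using assms unfolding halts_within_def by (meson exec.Seq add_mono)

lemma halts_within_Cond:
  assumes "bval q b M \<Longrightarrow> halts_within q c1 M T Q" "\<not> bval q b M \<Longrightarrow> halts_within q c2 M T Q"
  shows "halts_within q (Cond b c1 c2) M (1 + T) Q"
  using assms unfolding halts_within_def
  by (cases "bval q b M") (meson exec.CondTrue exec.CondFalse add_left_mono)+

lemma halts_within_mono:
  assumes "halts_within q c M T Q" "T \<le> T'" "\<And>M'. Q M' \<Longrightarrow> Q' M'"
  shows "halts_within q c M T' Q'"
  using assms unfolding halts_within_def by (meson le_trans)

text \<open>Indexing the invariant by finished rounds fixes their number as \<open>N\<close>, so no
  separate termination measure occurs. The cost is a test and a body per round, plus the final
  failing test.\<close>

lemma halts_within_While:
  assumes "I 0 M"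
    and "\<And>k M. k < N \<Longrightarrow> I k M \<Longrightarrow> bval q b M \<and> halts_within q c M T (I (Suc k))"
    and "\<And>M. I N M \<Longrightarrow> \<not> bval q b M"
  shows "halts_within q (While b c) M (1 + N * (1 + T)) (I N)"
  using assms
proof (induction N arbitrary: I M)
  case 0
  then show ?case
    unfolding halts_within_def by (auto intro!: exI exec.WhileFalse)
next
  case (Suc N)
  from Suc.prems(2)[of 0 M] Suc.prems(1) obtain t M'
    where b: "bval q b M" and M': "exec q c M t M'" "t \<le> T" "I (Suc 0) M'"
    unfolding halts_within_def by auto
  \<comment> \<open>After one round, the remaining \<open>N\<close> rounds start from the invariant
    shifted by one.\<close>
  have "halts_within q (While b c) M' (1 + N * (1 + T)) (I (Suc N))"
    using Suc.IH[of "\<lambda>k. I (Suc k)" M'] M'(3) Suc.prems(2,3) by auto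
  then obtain t' M'' where "exec q (While b c) M' t' M''" "t' \<le> 1 + N * (1 + T)" "I (Suc N) M''"
    unfolding halts_within_def by blast
  then show ?case
    unfolding halts_within_def using exec.WhileTrue[OF b M'(1)] M'(2) by fastforce
qed


section \<open>The greedy program\<close>

abbreviation NVar :: "string \<Rightarrow> nexp" where
  "NVar a \<equiv> NCell a (NConst 0)"

abbreviation NSet :: "string \<Rightarrow> nexp \<Rightarrow> com" where
  "NSet a e \<equiv> NAssign a (NConst 0) e"

abbreviation budget_fst :: "nexp \<Rightarrow> rexp" where
  "budget_fst i \<equiv> RCell ''budget'' (NCell ''fst'' i)"

abbreviation budget_snd :: "nexp \<Rightarrow> rexp" where
  "budget_snd i \<equiv> RCell ''budget'' (NCell ''snd'' i)"

abbreviation edge_value :: "nexp \<Rightarrow> rexp" where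
  "edge_value i \<equiv> Query i (budget_fst i) (budget_snd i)"

text \<open>The value \<open>m\<close> of the variable \<open>b\<close> means that no available edge has been found.\<close>

definition better_edge :: bexp where
  "better_edge = BAnd
     (BAnd (NLess (NCell ''used'' (NCell ''fst'' (NVar ''i''))) (NConst 1))
           (NLess (NCell ''used'' (NCell ''snd'' (NVar ''i''))) (NConst 1)))
     (BNot (BAnd (NLess (NVar ''b'') (NVar ''m''))
                 (BNot (RLess (edge_value (NVar ''b'')) (edge_value (NVar ''i''))))))"

definition scan_step :: com where
  "scan_step = Seq (Cond better_edge (NSet ''b'' (NVar ''i'')) Skip)
     (NSet ''i'' (NAdd (NVar ''i'') (NConst 1)))"

definition scan :: com where
  "scan = While (NLess (NVar ''i'') (NVar ''m'')) scan_step"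

definition pick :: com where
  "pick = Seq (RAssign ''out_fst'' (NVar ''b'') (budget_fst (NVar ''b'')))
     (Seq (RAssign ''out_snd'' (NVar ''b'') (budget_snd (NVar ''b'')))
     (Seq (NAssign ''used'' (NCell ''fst'' (NVar ''b'')) (NConst 1))
          (NAssign ''used'' (NCell ''snd'' (NVar ''b'')) (NConst 1))))"

definition greedy_round :: com where
  "greedy_round = Seq (NSet ''i'' (NConst 0)) (Seq (NSet ''b'' (NVar ''m'')) (Seq scan
     (Seq (Cond (NLess (NVar ''b'') (NVar ''m'')) pick Skip)
          (NSet ''k'' (NAdd (NVar ''k'') (NConst 1))))))"

text \<open>There is always one round per edge; once nothing is available, a round only scans. This
  gives the fixed number of rounds that the loop rule asks for.\<close>

definition greedy :: com where
  "greedy = While (NLess (NVar ''k'') (NVar ''m'')) greedy_round"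

section \<open>Greedy sets of edge numbers\<close>

locale presented_c0_game = c0_game G for G :: "'v game" +
  fixes vs :: "'v list" and es :: "(nat \<times> nat) list"
  assumes presents: "presents vs es G"
begin

definition "ends i = {fst (es ! i), snd (es ! i)}"
definition "val i = full_reward G (vs ! fst (es ! i)) (vs ! snd (es ! i))"
definition "covered S = (\<Union>i\<in>S. ends i)"
definition "avail S i \<longleftrightarrow> ends i \<inter> covered S = {}"

text \<open>Records not the order of picks but its effect: every blocked edge meets a picked edge of
  at least its value. This is what stability needs.\<close>

definition "greedy_set S \<longleftrightarrow> S \<subseteq> {..<length es} \<and>
  (\<forall>i\<in>S. \<forall>j\<in>S. ends i \<inter> ends j \<noteq> {} \<longrightarrow> i = j) \<and>
  (\<forall>i<length es. \<not> avail S i \<longrightarrow> (\<exists>j\<in>S. ends i \<inter> ends j \<noteq> {} \<and> val i \<le> val j))"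

lemma ends_less: "i < length es \<Longrightarrow> fst (es ! i) < length vs \<and> snd (es ! i) < length vs"
  using presents nth_mem[of i es] by (simp add: presents_def case_prod_beta)

lemma edge_at_edges: "i < length es \<Longrightarrow> edge_at vs (es ! i) \<in> edges G"
  using presents nth_mem[of i es] by (auto simp: presents_def)

lemma edge_at_inj:
  "i < length es \<Longrightarrow> j < length es \<Longrightarrow> edge_at vs (es ! i) = edge_at vs (es ! j) \<Longrightarrow> i = j"
  using presents by (auto simp: presents_def distinct_conv_nth)

lemma edges_conv: "edges G = (\<lambda>i. edge_at vs (es ! i)) ` {..<length es}"
proof -
  have "set es = (!) es ` {..<length es}" by (auto simp: set_conv_nth)
  then show ?thesis using presents by (simp add: presents_def image_image)
qed

lemma length_es: "length es = card (edges G)"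
  using presents distinct_card[of "map (edge_at vs) es"] by (simp add: presents_def)

lemma nth_vs_eq: "i < length vs \<Longrightarrow> j < length vs \<Longrightarrow> vs ! i = vs ! j \<longleftrightarrow> i = j"
  using presents by (simp add: presents_def nth_eq_iff_index_eq)

lemma edge_at_meet:
  "i < length es \<Longrightarrow> j < length es \<Longrightarrow>
    edge_at vs (es ! i) \<inter> edge_at vs (es ! j) \<noteq> {} \<longleftrightarrow> ends i \<inter> ends j \<noteq> {}"
  using ends_less[of i] ends_less[of j]
  by (auto simp: edge_at_def ends_def nth_vs_eq)

text \<open>A presentation may list the endpoints in either order; symmetry of the reward makes
  \<open>val\<close> independent of it.\<close>

lemma val_conv:
  assumes "i < length es" "edge_at vs (es ! i) = {u, v}"
  shows "val i = full_reward G u v"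
proof -
  have "full_reward G u v = full_reward G v u"
    using full_reward_commute edge_at_edges[OF assms(1)] assms(2) by simp
  then show ?thesis
    using assms(2) by (auto simp: edge_at_def val_def doubleton_eq_iff)
qed

text \<open>Budgets are nonnegative, so the query lies where the oracle returns the true
  reward.\<close>

lemma oracle_val:
  "i < length es \<Longrightarrow> reward_oracle vs es G i (budget G (vs ! fst (es ! i)))
    (budget G (vs ! snd (es ! i))) = val i"
  using edge_at_edges[of i] edge_verts budget_nonneg
  by (auto simp: reward_oracle_def val_def full_reward_def edge_at_def)

text \<open>An edge newly blocked by \<open>b\<close> was available before, so its value is at most
  that of \<open>b\<close>; edges blocked earlier keep their dominating edge.\<close>

lemma greedy_set_insert:
  assumes S: "greedy_set S" and b: "b < length es" "avail S b"
    and best: "\<And>i. i < length es \<Longrightarrow> avail S i \<Longrightarrow> val i \<le> val b"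
  shows "greedy_set (insert b S)"
proof -
  have disj: "ends b \<inter> ends j = {}" if "j \<in> S" for j
    using b that by (auto simp: avail_def covered_def)
  have "\<exists>j\<in>insert b S. ends i \<inter> ends j \<noteq> {} \<and> val i \<le> val j"
    if "i < length es" "\<not> avail (insert b S) i" for i
  proof (cases "avail S i")
    case True
    then show ?thesis using that best by (auto simp: avail_def covered_def)
  next
    case False
    then show ?thesis using S that by (auto simp: greedy_set_def)
  qed
  then show ?thesis
    using S b disj unfolding greedy_set_def by (simp add: Int_commute)
qed

text \<open>When nothing is available, every edge meets a picked edge of at least its value, and the
  shared endpoint is the one that stability asks for.\<close>

lemma stable_matching_greedy_set:
  assumes S: "greedy_set S" and max: "\<And>i. i < length es \<Longrightarrow> \<not> avail S i"
  shows "stable_matching G ((\<lambda>i. edge_at vs (es ! i)) ` S)"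
proof -
  have less: "i < length es" if "i \<in> S" for i
    using S that by (auto simp: greedy_set_def)
  have dominated: "(\<exists>w. {u, w} \<in> (\<lambda>i. edge_at vs (es ! i)) ` S \<and> full_reward G u v \<le> full_reward G u w) \<or>
        (\<exists>w. {v, w} \<in> (\<lambda>i. edge_at vs (es ! i)) ` S \<and> full_reward G v u \<le> full_reward G v w)"
    if uv: "{u, v} \<in> edges G" for u v
  proof -
    obtain i where i: "i < length es" "edge_at vs (es ! i) = {u, v}"
      using uv edges_conv by auto
    obtain j where j: "j \<in> S" "ends i \<inter> ends j \<noteq> {}" "val i \<le> val j"
      using S max[OF i(1)] i(1) unfolding greedy_set_def by blast
    then have "{u, v} \<inter> edge_at vs (es ! j) \<noteq> {}"
      using edge_at_meet[OF i(1) less[OF j(1)]] i by auto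
    then obtain x where x: "x = u \<or> x = v" "x \<in> edge_at vs (es ! j)" by blast
    then obtain w where w: "edge_at vs (es ! j) = {x, w}"
      by (auto simp: edge_at_def)
    have "val j = full_reward G x w" "val i = full_reward G u v" "val i = full_reward G v u"
      using val_conv[OF less[OF j(1)] w] val_conv[OF i] full_reward_commute[OF uv] by auto
    then show ?thesis
      using x j w by (metis image_eqI)
  qed
  have disjoint: "e = e'" if e: "e \<in> (\<lambda>i. edge_at vs (es ! i)) ` S"
    "e' \<in> (\<lambda>i. edge_at vs (es ! i)) ` S" "e \<inter> e' \<noteq> {}" for e e'
  proof -
    obtain i j where ij: "i \<in> S" "j \<in> S" "e = edge_at vs (es ! i)" "e' = edge_at vs (es ! j)"
      using e(1,2) by blast
    then have "ends i \<inter> ends j \<noteq> {}"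
      using e(3) edge_at_meet[OF less less] by simp
    then have "i = j"
      using S ij by (simp add: greedy_set_def)
    then show ?thesis using ij by simp
  qed
  have edges: "(\<lambda>i. edge_at vs (es ! i)) ` S \<subseteq> edges G"
    using less edge_at_edges by blast
  show ?thesis
    unfolding stable_matching_def
    by (intro conjI ballI allI impI; (rule edges | rule disjoint | rule dominated); assumption)
qed

section \<open>Loop invariants and running time\<close>

text \<open>The variables \<open>k\<close>, \<open>i\<close> and \<open>b\<close> do not occur, so
  assignments to them preserve it.\<close>

definition "represents M S \<longleftrightarrow> ncell M ''m'' 0 = length es \<and>
  (\<forall>i<length es. ncell M ''fst'' i = fst (es ! i) \<and> ncell M ''snd'' i = snd (es ! i)) \<and>
  (\<forall>i<length vs. rcell M ''budget'' i = budget G (vs ! i)) \<and>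
  (\<forall>x. ncell M ''used'' x = (if x \<in> covered S then 1 else 0)) \<and>
  (\<forall>i<length es. rcell M ''out_fst'' i = (if i \<in> S then budget G (vs ! fst (es ! i)) else 0) \<and>
    rcell M ''out_snd'' i = (if i \<in> S then budget G (vs ! snd (es ! i)) else 0))"

definition "best_below S i b \<longleftrightarrow>
  (if b < length es then avail S b \<and> (\<forall>j<i. avail S j \<longrightarrow> val j \<le> val b)
   else b = length es \<and> (\<forall>j<i. \<not> avail S j))"

definition "scan_inv S k i M \<longleftrightarrow> represents M S \<and> ncell M ''k'' 0 = k \<and>
  ncell M ''i'' 0 = i \<and> best_below S i (ncell M ''b'' 0)"

text \<open>A round either enlarges \<open>S\<close> or finds nothing available. After
  \<open>length es\<close> rounds both alternatives mean that nothing is available.\<close>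

definition "round_inv k M \<longleftrightarrow> ncell M ''k'' 0 = k \<and>
  (\<exists>S. represents M S \<and> greedy_set S \<and> (k \<le> card S \<or> (\<forall>i<length es. \<not> avail S i)))"

abbreviation "q \<equiv> reward_oracle vs es G"

text \<open>If \<open>b\<close> is the value for "none found", the guard \<open>b < m\<close> is
  false, so the result of the query at \<open>b\<close> does not affect the test.\<close>

lemma bval_better_edge:
  assumes "represents M S" "ncell M ''i'' 0 = i" "i < length es" "ncell M ''b'' 0 = b"
  shows "bval q better_edge M \<longleftrightarrow> avail S i \<and> \<not> (b < length es \<and> val i \<le> val b)"
  using assms ends_less[of i] ends_less[of b]
  by (auto simp: better_edge_def represents_def avail_def ends_def oracle_val not_less)

lemma scan_step_correct:
  assumes "i < length es" "scan_inv S k i M"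
  shows "halts_within q scan_step M 3 (scan_inv S k (Suc i))"
proof -
  let ?b = "ncell M ''b'' 0"
  have inv: "represents M S" "ncell M ''i'' 0 = i" "best_below S i ?b" "ncell M ''k'' 0 = k"
    using assms by (auto simp: scan_inv_def)
  note test = bval_better_edge[OF inv(1,2) assms(1) refl]
  \<comment> \<open>The bound has the shape produced by the rules: test and branch, then
    increment.\<close>
  have "halts_within q scan_step M ((1 + 1) + 1) (scan_inv S k (Suc i))"
    unfolding scan_step_def
  proof (intro halts_within_Seq halts_within_Cond halts_within_NAssign halts_within_Skip)
    assume "bval q better_edge M"
    \<comment> \<open>Either no earlier edge is available, or \<open>i\<close> strictly beats the
      previous best and hence every available edge before it.\<close>
    then have "best_below S (Suc i) i"
      using inv(3) assms(1) unfolding test best_below_def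
      by (auto simp: less_Suc_eq split: if_splits)
    then show "scan_inv S k (Suc i)
        (nset ''i'' (nval (NConst 0) (nset ''b'' (nval (NConst 0) M) (nval (NVar ''i'') M) M))
          (nval (NAdd (NVar ''i'') (NConst 1))
            (nset ''b'' (nval (NConst 0) M) (nval (NVar ''i'') M) M))
          (nset ''b'' (nval (NConst 0) M) (nval (NVar ''i'') M) M))"
      using inv by (simp add: scan_inv_def represents_def nset_def)
  next
    assume "\<not> bval q better_edge M"
    then have "best_below S (Suc i) ?b"
      using inv(3) assms(1) unfolding test best_below_def
      by (auto simp: less_Suc_eq split: if_splits)
    then show "scan_inv S k (Suc i)
        (nset ''i'' (nval (NConst 0) M) (nval (NAdd (NVar ''i'') (NConst 1)) M) M)"
      using inv by (simp add: scan_inv_def represents_def nset_def)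
  qed
  then show ?thesis by (rule halts_within_mono) auto
qed

lemma scan_correct:
  assumes "scan_inv S k 0 M"
  shows "halts_within q scan M (1 + length es * 4) (scan_inv S k (length es))"
proof -
  have "halts_within q scan M (1 + length es * (1 + 3)) (scan_inv S k (length es))"
    unfolding scan_def
  proof (rule halts_within_While[where I = "scan_inv S k"])
    show "scan_inv S k 0 M" by fact
    show "bval q (NLess (NVar ''i'') (NVar ''m'')) M' \<and>
        halts_within q scan_step M' 3 (scan_inv S k (Suc i))"
      if "i < length es" "scan_inv S k i M'" for i M'
      using scan_step_correct[OF that] that by (simp add: scan_inv_def represents_def)
  qed (simp add: scan_inv_def represents_def)
  then show ?thesis by simp
qed

text \<open>Between the assignments neither set need be represented, so all four updates are
  composed before the invariant is checked.\<close>

lemma pick_correct: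
  assumes "represents M S" "ncell M ''k'' 0 = k" "ncell M ''b'' 0 = b" "b < length es"
  shows "halts_within q pick M 4 (\<lambda>M'. represents M' (insert b S) \<and> ncell M' ''k'' 0 = k)"
proof -
  have "halts_within q pick M (1 + (1 + (1 + 1)))
      (\<lambda>M'. represents M' (insert b S) \<and> ncell M' ''k'' 0 = k)"
    unfolding pick_def
    by (intro halts_within_Seq halts_within_NAssign halts_within_RAssign)
      (use assms ends_less[of b] in
        \<open>auto simp: represents_def nset_def rset_def covered_def ends_def\<close>)
  then show ?thesis by (rule halts_within_mono) auto
qed

lemma covered_not_avail: "i \<in> S \<Longrightarrow> \<not> avail S i"
  by (auto simp: avail_def covered_def ends_def)

text \<open>The 9 counts two initial assignments, the final test of the scan, five steps for the
  conditional and one increment; each scanned edge costs 4.\<close>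

lemma greedy_round_correct:
  assumes "k < length es" "round_inv k M"
  shows "halts_within q greedy_round M (9 + length es * 4) (round_inv (Suc k))"
proof -
  obtain S where S: "represents M S" "greedy_set S"
    "k \<le> card S \<or> (\<forall>i<length es. \<not> avail S i)" and k: "ncell M ''k'' 0 = k"
    using assms by (auto simp: round_inv_def)
  have fin: "finite S" using S by (auto simp: greedy_set_def intro: finite_subset)
  let ?m = "length es"
  \<comment> \<open>Before any edge is scanned, "none found" is correct vacuously.\<close>
  have start: "scan_inv S k 0 (nset ''b'' 0 (ncell M ''m'' 0) (nset ''i'' 0 0 M))"
    using S k by (simp add: scan_inv_def represents_def nset_def best_below_def)
  have finish: "halts_within q (Seq (Cond (NLess (NVar ''b'') (NVar ''m'')) pick Skip)
      (NSet ''k'' (NAdd (NVar ''k'') (NConst 1)))) M' ((1 + 4) + 1) (round_inv (Suc k))"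
    if inv: "scan_inv S k ?m M'" for M'
  proof -
    let ?b = "ncell M' ''b'' 0"
    have M': "represents M' S" "ncell M' ''k'' 0 = k" "best_below S ?m ?b" "ncell M' ''m'' 0 = ?m"
      using inv by (auto simp: scan_inv_def represents_def)
    let ?Q = "\<lambda>M'. halts_within q (NSet ''k'' (NAdd (NVar ''k'') (NConst 1))) M' 1
        (round_inv (Suc k))"
    have incr: "?Q M''"
      if "represents M'' S'" "greedy_set S'" "Suc k \<le> card S' \<or> (\<forall>i<?m. \<not> avail S' i)"
        "ncell M'' ''k'' 0 = k" for M'' S'
      using that unfolding round_inv_def
      by (intro halts_within_NAssign conjI exI[of _ S'])
        (auto simp: represents_def nset_def)
    show ?thesis
    proof (intro halts_within_Seq halts_within_Cond)
      assume "bval q (NLess (NVar ''b'') (NVar ''m'')) M'"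
      then have b: "?b < ?m" using M' by simp
      then have avail: "avail S ?b" and best: "\<And>i. i < ?m \<Longrightarrow> avail S i \<Longrightarrow> val i \<le> val ?b"
        using M'(3) by (auto simp: best_below_def)
      \<comment> \<open>An available edge excludes the second alternative of the invariant, and it
        is not yet in \<open>S\<close>, so inserting it raises the cardinality.\<close>
      have "k \<le> card S" "?b \<notin> S"
        using S(3) avail b covered_not_avail by auto
      then have "Suc k \<le> card (insert ?b S)" using fin by simp
      moreover have "greedy_set (insert ?b S)"
        by (rule greedy_set_insert[OF S(2) b avail best])
      ultimately have "?Q M''" if "represents M'' (insert ?b S) \<and> ncell M'' ''k'' 0 = k" for M''
        using that by (intro incr[of M'' "insert ?b S"] disjI1) simp_all
      then show "halts_within q pick M' 4 ?Q"
        by (rule halts_within_mono[OF pick_correct[OF M'(1,2) refl b] order_refl])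
    next
      assume "\<not> bval q (NLess (NVar ''b'') (NVar ''m'')) M'"
      then have "\<forall>i<?m. \<not> avail S i"
        using M' by (auto simp: best_below_def)
      then have "?Q M'"
        by (intro incr[OF M'(1) S(2) disjI2 M'(2)])
      then show "halts_within q Skip M' 4 ?Q"
        by (rule halts_within_mono[OF halts_within_Skip[of ?Q]]) simp_all
    qed
  qed
  have scan: "halts_within q scan (nset ''b'' 0 (ncell M ''m'' 0) (nset ''i'' 0 0 M)) (1 + ?m * 4)
      (\<lambda>M'. halts_within q (Seq (Cond (NLess (NVar ''b'') (NVar ''m'')) pick Skip)
        (NSet ''k'' (NAdd (NVar ''k'') (NConst 1)))) M' ((1 + 4) + 1) (round_inv (Suc k)))"
    by (rule halts_within_mono[OF scan_correct[OF start] order_refl]) (rule finish)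
  have "halts_within q greedy_round M (1 + (1 + ((1 + ?m * 4) + ((1 + 4) + 1))))
      (round_inv (Suc k))"
    unfolding greedy_round_def
    by (rule halts_within_Seq halts_within_NAssign)+ (use scan in \<open>simp add: nset_def\<close>)
  then show ?thesis by (rule halts_within_mono) auto
qed

lemma greedy_correct:
  "halts_within q greedy (input_memory vs es G) (1 + length es * (10 + length es * 4))
    (round_inv (length es))"
proof -
  have "halts_within q greedy (input_memory vs es G) (1 + length es * (1 + (9 + length es * 4)))
    (round_inv (length es))"
    unfolding greedy_def
  proof (rule halts_within_While[where I = round_inv])
    \<comment> \<open>Cells outside the input are 0, which encodes that nothing is used and nothing
      is contributed.\<close>
    have "represents (input_memory vs es G) {}"
      by (simp add: represents_def input_memory_def covered_def)
    moreover have "greedy_set {}"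
      by (simp add: greedy_set_def avail_def covered_def)
    ultimately show "round_inv 0 (input_memory vs es G)"
      by (auto simp: round_inv_def input_memory_def)
    show "bval q (NLess (NVar ''k'') (NVar ''m'')) M \<and>
        halts_within q greedy_round M (9 + length es * 4) (round_inv (Suc k))"
      if "k < length es" "round_inv k M" for k M
      using greedy_round_correct[OF that] that by (auto simp: round_inv_def represents_def)
  qed (auto simp: round_inv_def represents_def)
  then show ?thesis by simp
qed

lemma round_inv_equilibrium:
  assumes "round_inv (length es) M"
  shows "\<exists>s. output_state vs es M s \<and> pairwise_equilibrium G s"
proof -
  obtain S where S: "represents M S" "greedy_set S"
    "length es \<le> card S \<or> (\<forall>i<length es. \<not> avail S i)"
    using assms by (auto simp: round_inv_def)
  have sub: "S \<subseteq> {..<length es}" using S by (simp add: greedy_set_def)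
  have "\<not> avail S i" if "i < length es" for i
    using S(3)
  proof
    assume "length es \<le> card S"
    then have "S = {..<length es}" using sub by (intro card_seteq) auto
    then show ?thesis using that covered_not_avail by auto
  qed (use that in auto)
  then have stable: "stable_matching G ((\<lambda>i. edge_at vs (es ! i)) ` S)"
    using stable_matching_greedy_set[OF S(2)] by blast
  \<comment> \<open>Distinct numbers present distinct edges, so the output cells for
    \<open>S\<close> agree with the state of the matching.\<close>
  have "edge_at vs (es ! i) \<in> (\<lambda>i. edge_at vs (es ! i)) ` S \<longleftrightarrow> i \<in> S" if "i < length es" for i
    using that sub edge_at_inj by blast
  then have "output_state vs es M (matching_state G ((\<lambda>i. edge_at vs (es ! i)) ` S))"
    using S(1) by (simp add: output_state_def matching_state_def represents_def)
  then show ?thesis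
    using pairwise_equilibrium_matching_state[OF stable] by blast
qed

theorem greedy_computes_equilibrium:
  "\<exists>t M s. exec q greedy (input_memory vs es G) t M \<and>
     t \<le> poly [:1, 10, 4:] (card (verts G) + card (edges G)) \<and>
     output_state vs es M s \<and> pairwise_equilibrium G s"
proof -
  obtain t M where run: "exec q greedy (input_memory vs es G) t M"
    "t \<le> 1 + length es * (10 + length es * 4)" "round_inv (length es) M"
    using greedy_correct by (auto simp: halts_within_def)
  \<comment> \<open>The right-hand side is the Horner form of \<open>[:1, 10, 4:]\<close>.\<close>
  have "1 + length es * (10 + length es * 4)
      \<le> 1 + (card (verts G) + card (edges G)) * (10 + (card (verts G) + card (edges G)) * 4)"
    unfolding length_es by (intro add_mono mult_mono) auto
  then have "t \<le> poly [:1, 10, 4:] (card (verts G) + card (edges G))"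
    using run(2) by simp
  then show ?thesis
    using run round_inv_equilibrium by blast
qed

end

section \<open>Existence of presentations and conclusion\<close>

text \<open>With it, the existence of an equilibrium follows from a run of the algorithm on some
  presentation.\<close>

lemma (in c0_game) presents_exists: "\<exists>vs es. presents vs es G"
proof -
  obtain vs where vs: "set vs = verts G" "distinct vs"
    using finite_distinct_list[OF finite_verts] by blast
  obtain el where el: "set el = edges G" "distinct el"
    using finite_distinct_list[OF finite_edges] by blast
  have "\<exists>p. fst p < length vs \<and> snd p < length vs \<and> edge_at vs p = e" if e: "e \<in> edges G" for e
  proof -
    have "card e = 2" "e \<subseteq> set vs"
      using e game vs by (auto simp: network_contribution_game_def)
    then obtain u v where "e = {u, v}" "u \<in> set vs" "v \<in> set vs"
      by (auto simp: card_2_iff)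
    then obtain i j where "i < length vs" "j < length vs" "e = {vs ! i, vs ! j}"
      by (metis in_set_conv_nth)
    then show ?thesis by (intro exI[of _ "(i, j)"]) (simp add: edge_at_def)
  qed
  then obtain p where p: "\<And>e. e \<in> edges G \<Longrightarrow>
      fst (p e) < length vs \<and> snd (p e) < length vs \<and> edge_at vs (p e) = e"
    by metis
  \<comment> \<open>Decoding the chosen pairs returns the edge list, so its distinctness carries
    over.\<close>
  have "map (edge_at vs) (map p el) = el"
    using p el(1) by (auto intro: map_idI)
  then have "presents vs (map p el) G"
    unfolding presents_def set_map[symmetric] using vs el p by (simp add: case_prod_beta)
  then show ?thesis by blast
qed

theorem theorem2p5:
  shows "(\<forall>G :: 'v game.
            network_contribution_game G \<and> (\<forall>e\<in>edges G. reward G e \<in> class_C0) \<longrightarrow>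
            (\<exists>s. pairwise_equilibrium G s)) \<and>
         (\<exists>(c :: com) (p :: nat poly). \<forall>(G :: 'v game) vs es.
            network_contribution_game G \<and> (\<forall>e\<in>edges G. reward G e \<in> class_C0) \<and>
            presents vs es G \<longrightarrow>
            (\<exists>t M s. exec (reward_oracle vs es G) c (input_memory vs es G) t M \<and>
               t \<le> poly p (card (verts G) + card (edges G)) \<and>
               output_state vs es M s \<and> pairwise_equilibrium G s))"
proof
  show "\<forall>G :: 'v game.
      network_contribution_game G \<and> (\<forall>e\<in>edges G. reward G e \<in> class_C0) \<longrightarrow>
      (\<exists>s. pairwise_equilibrium G s)"
  proof (intro allI impI)
    fix G :: "'v game"
    assume "network_contribution_game G \<and> (\<forall>e\<in>edges G. reward G e \<in> class_C0)"
    then interpret c0_game G by unfold_locales auto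
    obtain vs es where "presents vs es G" using presents_exists by blast
    then interpret presented_c0_game G vs es by unfold_locales
    show "\<exists>s. pairwise_equilibrium G s" using greedy_computes_equilibrium by blast
  qed
  show "\<exists>(c :: com) (p :: nat poly). \<forall>(G :: 'v game) vs es.
      network_contribution_game G \<and> (\<forall>e\<in>edges G. reward G e \<in> class_C0) \<and>
      presents vs es G \<longrightarrow>
      (\<exists>t M s. exec (reward_oracle vs es G) c (input_memory vs es G) t M \<and>
         t \<le> poly p (card (verts G) + card (edges G)) \<and>
         output_state vs es M s \<and> pairwise_equilibrium G s)"
  proof (rule exI[of _ greedy], rule exI[of _ "[:1, 10, 4:]"], intro allI impI)
    fix G :: "'v game" and vs es
    assume "network_contribution_game G \<and> (\<forall>e\<in>edges G. reward G e \<in> class_C0) \<and>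
      presents vs es G"
    then interpret presented_c0_game G vs es by unfold_locales auto
    show "\<exists>t M s. exec (reward_oracle vs es G) greedy (input_memory vs es G) t M \<and>
        t \<le> poly [:1, 10, 4:] (card (verts G) + card (edges G)) \<and>
        output_state vs es M s \<and> pairwise_equilibrium G s"
      by (rule greedy_computes_equilibrium)
  qed
qed

end
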